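(* Let $\alpha$ be an infinite permutation (that is, an $\mathbb N$-permutation). Then $\alpha$ is not ultimately periodic if and only if $p^*_{\alpha}(n)\geq n$ for every integer $n\geq 1$.
   Context: $\mathbb N=\{0,1,2,\dots\}$. For $S\subseteq\mathbb N$, an $S$-permutation $\alpha$ is an equivalence class of sequences $(a_s)_{s\in S}$ of pairwise distinct real numbers, where $(a_s)\sim(b_s)$ if and only if for all $s,r\in S$ one has $a_s<a_r \iff b_s<b_r$. Equivalently, it is a linear ordering of the index set $S$; we write $\alpha_i<\alpha_j$ or $\alpha_i>\alpha_j$ for this order. An infinite permutation is an $\mathbb N$-permutation. For $i\ne j$ let $\gamma_{ij}\in\{<,>\}$ be the relation such that $\alpha_i\,\gamma_{ij}\,\alpha_j$. An $\mathbb N$-permutation $\alpha$ is ultimately $t$-periodic ($t\ge 1$) if there is $n_0$ such that $\gamma_{ij}=\gamma_{i+t,j+t}$ for all $i\neq j$ with $i,j>n_0$; it is ultimately periodic if it is ultimately $t$-periodic for some $t\geq 1$. A window is a finite set $T=\{0,m_1,\dots,m_{k-1}\}\subset\mathbb N$ with $0<m_1<\dots<m_{k-1}$; $\#T=k$ is its cardinality. For $n\in\mathbb N$ the $T$-factor $\alpha_{T+n}$ is the restriction of $\alpha$ to $T+n$, regarded as a permutation on $T$ (via the shift by $n$). The number of distinct $T$-factors of $\alpha$ is denoted $p_\alpha(T)$. The maximal pattern complexity of $\alpha$ is $p^*_\alpha(n)=\max_{\#T=n}p_\alpha(T)$, the maximum over all windows $T$ of cardinality $n$. *)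

theory Defs
  imports Complex_Main
begin

text \<open>
  A sequence indexed by \<open>S\<close> is represented by a total function \<open>nat \<Rightarrow> real\<close>; functions that agree
  on \<open>S\<close> are related by \<open>perm_rel S\<close>, so the values outside \<open>S\<close> play no role in the quotient.
\<close>

definition perm_rel :: "nat set \<Rightarrow> ((nat \<Rightarrow> real) \<times> (nat \<Rightarrow> real)) set" where
  "perm_rel S = {(a, b). inj_on a S \<and> inj_on b S \<and>
                         (\<forall>s\<in>S. \<forall>r\<in>S. a s < a r \<longleftrightarrow> b s < b r)}"

definition index_permutations :: "nat set \<Rightarrow> (nat \<Rightarrow> real) set set" where
  "index_permutations S = {a. inj_on a S} // perm_rel S"

abbreviation infinite_permutations :: "(nat \<Rightarrow> real) set set" where
  "infinite_permutations \<equiv> index_permutations UNIV"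

definition perm_less :: "(nat \<Rightarrow> real) set \<Rightarrow> nat \<Rightarrow> nat \<Rightarrow> bool" where
  "perm_less \<alpha> i j \<longleftrightarrow> (\<exists>a\<in>\<alpha>. a i < a j)"

text \<open>
  For \<open>i \<noteq> j\<close> exactly one of \<open>perm_less \<alpha> i j\<close> and \<open>perm_less \<alpha> j i\<close> holds, so equality of
  the relations at \<open>(i, j)\<close> and \<open>(i + t, j + t)\<close> is the equivalence below.
\<close>

definition ultimately_t_periodic :: "nat \<Rightarrow> (nat \<Rightarrow> real) set \<Rightarrow> bool" where
  "ultimately_t_periodic t \<alpha> \<longleftrightarrow>
     t \<ge> 1 \<and> (\<exists>n0. \<forall>i j. i \<noteq> j \<and> i > n0 \<and> j > n0 \<longrightarrow>
                  (perm_less \<alpha> i j \<longleftrightarrow> perm_less \<alpha> (i + t) (j + t)))"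

definition ultimately_periodic :: "(nat \<Rightarrow> real) set \<Rightarrow> bool" where
  "ultimately_periodic \<alpha> \<longleftrightarrow> (\<exists>t. ultimately_t_periodic t \<alpha>)"

definition window :: "nat set \<Rightarrow> bool" where
  "window T \<longleftrightarrow> finite T \<and> 0 \<in> T"

definition perm_factor :: "(nat \<Rightarrow> real) set \<Rightarrow> nat set \<Rightarrow> nat \<Rightarrow> (nat \<Rightarrow> real) set" where
  "perm_factor \<alpha> T n = perm_rel T `` ((\<lambda>a s. a (s + n)) ` \<alpha>)"

definition factor_complexity :: "(nat \<Rightarrow> real) set \<Rightarrow> nat set \<Rightarrow> nat" where
  "factor_complexity \<alpha> T = card (range (perm_factor \<alpha> T))"

definition max_pattern_complexity :: "(nat \<Rightarrow> real) set \<Rightarrow> nat \<Rightarrow> nat" where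
  "max_pattern_complexity \<alpha> n = Max {factor_complexity \<alpha> T | T. window T \<and> card T = n}"


lemma equiv_perm_rel: "equiv {a. inj_on a S} (perm_rel S)"
  by (intro equivI refl_onI symI transI) (auto simp: perm_rel_def)

lemma infinite_permutationE:
  assumes "\<alpha> \<in> infinite_permutations"
  obtains a where "inj a" "\<alpha> = perm_rel UNIV `` {a}"
  using assms by (auto simp: index_permutations_def quotient_def)

lemma perm_less_class:
  assumes "inj a"
  shows "perm_less (perm_rel UNIV `` {a}) i j \<longleftrightarrow> a i < a j"
  using assms by (auto simp: perm_less_def perm_rel_def)

lemma perm_less_linear:
  assumes "\<alpha> \<in> infinite_permutations" "i \<noteq> j"
  shows "perm_less \<alpha> i j \<longleftrightarrow> \<not> perm_less \<alpha> j i"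
proof -
  obtain a where a: "inj a" "\<alpha> = perm_rel UNIV `` {a}"
    using assms(1) by (rule infinite_permutationE)
  then have "a i \<noteq> a j" using assms(2) by (simp add: inj_eq)
  then show ?thesis using a by (auto simp: perm_less_class)
qed

lemma perm_factor_class:
  assumes "inj a"
  shows "perm_factor (perm_rel UNIV `` {a}) T n = perm_rel T `` {\<lambda>s. a (s + n)}"
proof
  show "perm_rel T `` {\<lambda>s. a (s + n)} \<subseteq> perm_factor (perm_rel UNIV `` {a}) T n"
    using assms by (auto simp: perm_factor_def perm_rel_def)
next
  have "inj_on (\<lambda>s. a (s + n)) T"
    using assms by (intro inj_onI) (auto dest: injD)
  then show "perm_factor (perm_rel UNIV `` {a}) T n \<subseteq> perm_rel T `` {\<lambda>s. a (s + n)}"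
    by (auto simp: perm_factor_def perm_rel_def)
qed

lemma perm_factor_in_index_permutations:
  assumes "\<alpha> \<in> infinite_permutations"
  shows "perm_factor \<alpha> T n \<in> index_permutations T"
proof -
  obtain a where a: "inj a" "\<alpha> = perm_rel UNIV `` {a}"
    using assms by (rule infinite_permutationE)
  then have "inj_on (\<lambda>s. a (s + n)) T"
    by (intro inj_onI) (auto dest: injD)
  with a show ?thesis
    by (auto simp: perm_factor_class index_permutations_def intro: quotientI)
qed

lemma index_permutations_bound:
  assumes "finite T"
  shows "finite (index_permutations T) \<and> card (index_permutations T) \<le> 2 ^ (card T * card T)"
proof -
  define f where "f a = {(s, r) \<in> T \<times> T. a s < a r}" for a :: "nat \<Rightarrow> real"
  have sub: "index_permutations T \<subseteq>
      (\<lambda>R. {b. inj_on b T \<and> f b = R}) ` Pow (T \<times> T)"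
  proof
    fix X assume "X \<in> index_permutations T"
    then obtain a where a: "inj_on a T" "X = perm_rel T `` {a}"
      by (auto simp: index_permutations_def quotient_def)
    have "X = {b. inj_on b T \<and> f b = f a}"
      using a by (auto simp: perm_rel_def f_def set_eq_iff)
    moreover have "f a \<in> Pow (T \<times> T)" by (auto simp: f_def)
    ultimately show "X \<in> (\<lambda>R. {b. inj_on b T \<and> f b = R}) ` Pow (T \<times> T)" by blast
  qed
  have fin: "finite (Pow (T \<times> T))" using assms by simp
  have "card (index_permutations T) \<le> card (Pow (T \<times> T))"
    using surj_card_le[OF fin sub] .
  moreover have "card (Pow (T \<times> T)) = 2 ^ (card T * card T)"
    using assms by (simp add: card_Pow card_cartesian_product)
  ultimately show ?thesis
    using finite_subset[OF sub] fin by simp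
qed

text \<open>The maximum defining \<open>max_pattern_complexity\<close> is taken over a finite nonempty set.\<close>

lemma factor_complexity_set:
  assumes "\<alpha> \<in> infinite_permutations"
  shows "finite {factor_complexity \<alpha> T | T. window T \<and> card T = n}"
    and "n \<ge> 1 \<Longrightarrow> {factor_complexity \<alpha> T | T. window T \<and> card T = n} \<noteq> {}"
proof -
  have "factor_complexity \<alpha> T \<le> 2 ^ (n * n)" if "window T" "card T = n" for T
  proof -
    have "finite T" using that by (simp add: window_def)
    note b = index_permutations_bound[OF this]
    have "range (perm_factor \<alpha> T) \<subseteq> index_permutations T"
      using perm_factor_in_index_permutations[OF assms] by blast
    then have "factor_complexity \<alpha> T \<le> card (index_permutations T)"
      unfolding factor_complexity_def using b by (intro card_mono) auto
    with b that show ?thesis by simp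
  qed
  then have "{factor_complexity \<alpha> T | T. window T \<and> card T = n} \<subseteq> {..2 ^ (n * n)}" by auto
  then show "finite {factor_complexity \<alpha> T | T. window T \<and> card T = n}"
    by (rule finite_subset) simp
next
  assume "n \<ge> 1"
  then have "window {..<n}" "card {..<n} = n" by (auto simp: window_def)
  then show "{factor_complexity \<alpha> T | T. window T \<and> card T = n} \<noteq> {}" by blast
qed

end

theory Submission
  imports Defs
begin

text \<open>
  For a representative \<open>a\<close> and \<open>m \<ge> 1\<close> let \<open>v\<^sub>m\<close> be the word \<open>i \<mapsto> (a i < a (i + m))\<close>. If some \<open>v\<^sub>m\<close>
  is not ultimately periodic, the Morse--Hedlund argument along the progression
  \<open>0, m, 2m, \<dots>, (n - 1)m\<close>, whose factors determine \<open>n - 1\<close> letters of \<open>v\<^sub>m\<close>, gives \<open>n\<close> factors.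
  Otherwise all \<open>v\<^sub>m\<close> are ultimately periodic. If the maximal pattern complexity were below \<open>n\<close>
  somewhere, it would fail to increase at some step, so an optimal window \<open>T\<close> would have the
  property that the \<open>T\<close>-factor at \<open>i\<close> determines the factor at \<open>i\<close> of every window
  \<open>T \<union> {m}\<close>. As \<open>0 \<in> T\<close>, only finitely many profiles \<open>m \<mapsto> v\<^sub>m i\<close> would occur, they would be told
  apart by finitely many \<open>v\<^sub>m\<close>, and a common period of these would be a period of the permutation.
\<close>

section \<open>Preliminaries: periodic sequences, finite ranges, plateaus\<close>

definition ultimately_periodic_seq :: "(nat \<Rightarrow> 'a) \<Rightarrow> bool" where
  "ultimately_periodic_seq v \<longleftrightarrow> (\<exists>t\<ge>1. \<exists>n0. \<forall>i\<ge>n0. v (i + t) = v i)"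

lemma periodic_mult:
  fixes v :: "nat \<Rightarrow> 'a"
  assumes "\<forall>i\<ge>n0. v (i + t) = v i" "i \<ge> n0"
  shows "v (i + k * t) = v i"
proof (induction k)
  case (Suc k)
  have "v (i + k * t + t) = v (i + k * t)" using assms by simp
  with Suc show ?case by (simp add: algebra_simps)
qed simp

lemma common_period:
  assumes "finite F" "\<And>x. x \<in> F \<Longrightarrow> ultimately_periodic_seq (v x)"
  shows "\<exists>t\<ge>1. \<exists>n0. \<forall>x\<in>F. \<forall>i\<ge>n0. v x (i + t) = v x i"
  using assms
proof (induction F rule: finite_induct)
  case (insert x F)
  then obtain t n0 where t: "t \<ge> 1" "\<forall>y\<in>F. \<forall>i\<ge>n0. v y (i + t) = v y i" by auto
  from insert.prems[of x] obtain t' n1 where t': "t' \<ge> 1" "\<forall>i\<ge>n1. v x (i + t') = v x i"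
    by (auto simp: ultimately_periodic_seq_def)
  \<comment> \<open>The product is a multiple of both periods, and beyond the larger threshold both
    apply.\<close>
  have "v y (i + t * t') = v y i" if "y \<in> insert x F" "i \<ge> max n0 n1" for y i
  proof (cases "y = x")
    case True
    then show ?thesis using periodic_mult[OF t'(2), of i t] that by simp
  next
    case False
    then show ?thesis
      using periodic_mult[of n0 "v y" t i t'] t(2) that by (simp add: mult.commute)
  qed
  moreover have "t * t' \<ge> 1" using t t' by simp
  ultimately show ?case by blast
qed auto

text \<open>As \<open>f\<close> factors through \<open>g\<close>, there is a surjection from the
  range of \<open>g\<close> onto that of \<open>f\<close>; between finite sets, onto one at least as
  large, it is injective. This turns a plateau of a complexity into determinism.\<close>

lemma card_range_le_determines:
  assumes "finite (range g)" "\<And>i j. g i = g j \<Longrightarrow> f i = f j"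
    and "card (range g) \<le> card (range f)" "f i = f j"
  shows "g i = g j"
proof -
  define h where "h y = f (inv g y)" for y
  have h: "h (g i) = f i" for i
    unfolding h_def by (rule assms(2)) (simp add: f_inv_into_f)
  then have "h ` range g = range f" by (simp add: image_image)
  moreover from this have "card (h ` range g) = card (range g)"
    using assms(1,3) card_image_le[OF assms(1), of h] by simp
  ultimately have "inj_on h (range g)" using assms(1) eq_card_imp_inj_on by blast
  then show ?thesis using h assms(4) by (metis inj_onD rangeI)
qed

lemma range_mono:
  assumes "finite (range g)" "\<And>i j. g i = g j \<Longrightarrow> f i = f j"
  shows finite_range_mono: "finite (range f)"
    and card_range_mono: "card (range f) \<le> card (range g)"
proof -
  have "f i = f (inv g (g i))" for i by (rule assms(2)) (simp add: f_inv_into_f)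
  then have sub: "range f \<subseteq> (\<lambda>y. f (inv g y)) ` range g" by auto
  show "finite (range f)" using assms(1) sub by (rule finite_surj)
  show "card (range f) \<le> card (range g)" using assms(1) sub by (rule surj_card_le)
qed

text \<open>Strict growth at every step would keep \<open>c\<close> on or above the line
  \<open>n + d\<close>. The offset \<open>d\<close> covers both uses: words, counted from length 0
  with one empty factor, and windows, counted from cardinality 1.\<close>

lemma slow_growth_plateau:
  fixes c :: "nat \<Rightarrow> nat"
  assumes "c k \<ge> k + d" "k \<le> l" "c l < l + d"
  shows "\<exists>n\<ge>k. c (Suc n) \<le> c n"
proof (rule ccontr)
  assume "\<not> ?thesis"
  then have inc: "c n < c (Suc n)" if "n \<ge> k" for n using that by force
  have "c l \<ge> l + d" using assms(2)
  proof (induction l rule: dec_induct)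
    case (step n)
    then show ?case using inc[of n] by linarith
  qed (rule assms(1))
  with assms(3) show False by simp
qed

section \<open>Morse--Hedlund along an arithmetic progression\<close>

definition progression_factor :: "(nat \<Rightarrow> 'a) \<Rightarrow> nat \<Rightarrow> nat \<Rightarrow> nat \<Rightarrow> 'a list" where
  "progression_factor v m k i = map (\<lambda>j. v (i + j * m)) [0..<k]"

lemma progression_factor_eq_iff:
  "progression_factor v m k i = progression_factor v m k j \<longleftrightarrow>
     (\<forall>l<k. v (i + l * m) = v (j + l * m))"
  by (auto simp: progression_factor_def)

lemma finite_range_progression_factor:
  fixes v :: "nat \<Rightarrow> 'a::finite"
  shows "finite (range (progression_factor v m k))"
proof (rule finite_subset)
  show "range (progression_factor v m k) \<subseteq> {xs. set xs \<subseteq> UNIV \<and> length xs = k}"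
    by (auto simp: progression_factor_def)
qed (simp only: finite_lists_length_eq[OF finite_UNIV])

text \<open>At a plateau \<open>n\<close> the factor at \<open>i\<close> determines one more letter,
  hence the factor at \<open>i + m\<close>. Each residue class modulo \<open>m\<close> thus evolves
  deterministically through finitely many states.\<close>

lemma morse_hedlund_progression:
  fixes v :: "nat \<Rightarrow> 'a::finite"
  assumes m: "m \<ge> 1" and le: "card (range (progression_factor v m k)) \<le> k"
  shows "ultimately_periodic_seq v"
proof -
  let ?F = "progression_factor v m"
  have fin: "finite (range (?F k))" for k by (rule finite_range_progression_factor)
  have "range (?F 0) = {[]}" by (auto simp: progression_factor_def)
  then have "card (range (?F 0)) = 1" by simp
  then obtain n where n: "card (range (?F (Suc n))) \<le> card (range (?F n))"
    using slow_growth_plateau[of 0 1 "\<lambda>k. card (range (?F k))" k] le by auto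
  have ext: "?F (Suc n) i = ?F (Suc n) j" if "?F n i = ?F n j" for i j
    using fin _ n that
    by (rule card_range_le_determines) (auto simp: progression_factor_eq_iff)
  have step: "?F n (i + m) = ?F n (j + m)" if "?F n i = ?F n j" for i j
    unfolding progression_factor_eq_iff
  proof (intro allI impI)
    fix l assume "l < n"
    then have "v (i + Suc l * m) = v (j + Suc l * m)"
      using ext[OF that] unfolding progression_factor_eq_iff by blast
    then show "v (i + m + l * m) = v (j + m + l * m)" by (simp add: add.assoc)
  qed
  have steps: "?F n (i + k * m) = ?F n (j + k * m)" if "?F n i = ?F n j" for i j k
  proof (induction k)
    case (Suc k)
    show ?case using step[OF Suc] by (simp add: algebra_simps)
  qed (simp add: that)
  \<comment> \<open>The letter is read from the factor of length \<open>Suc n\<close>, because for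
    \<open>n = 0\<close> the factor of length \<open>n\<close> is empty.\<close>
  have letter: "v i = v j" if "?F n i = ?F n j" for i j
    using ext[OF that] unfolding progression_factor_eq_iff by force
  \<comment> \<open>A block holds one state from each residue class modulo \<open>m\<close>, so a
    single coincidence of two blocks gives a period common to all classes.\<close>
  define B where "B p = map (\<lambda>r. ?F n (p * m + r)) [0..<m]" for p
  have "range B \<subseteq> {xs. set xs \<subseteq> range (?F n) \<and> length xs = m}"
    by (auto simp: B_def)
  then have "finite (range B)"
    using finite_lists_length_eq[OF fin] by (rule finite_subset)
  then have "\<not> inj B" using finite_imageD by blast
  then obtain p q where "B p = B q" "p < q"
    unfolding inj_def by (metis nat_neq_iff)
  have "v (i + (q - p) * m) = v i" if "i \<ge> p * m" for i
  proof -
    define r where "r = (i - p * m) mod m"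
    define d where "d = (i - p * m) div m"
    have "r < m" using m by (simp add: r_def)
    have i: "i = p * m + r + d * m" using that by (simp add: r_def d_def)
    have "?F n (p * m + r) = ?F n (q * m + r)"
      using \<open>B p = B q\<close> \<open>r < m\<close> by (auto simp: B_def)
    then have "v (p * m + r + d * m) = v (q * m + r + d * m)"
      by (intro letter steps)
    moreover have "q * m = p * m + (q - p) * m"
      using \<open>p < q\<close> by (simp add: add_mult_distrib[symmetric])
    ultimately show ?thesis by (simp add: i algebra_simps)
  qed
  moreover have "(q - p) * m \<ge> 1" using \<open>p < q\<close> m by simp
  ultimately show ?thesis unfolding ultimately_periodic_seq_def by blast
qed

text \<open>One point of disagreement is chosen for each pair of functions; for equal functions the
  choice is arbitrary and harmless.\<close>

lemma finite_separating_set: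
  assumes "finite R"
  shows "\<exists>F. finite F \<and> (\<forall>p\<in>R. \<forall>q\<in>R. (\<forall>x\<in>F. p x = q x) \<longrightarrow> p = q)"
proof (intro exI conjI)
  let ?F = "(\<lambda>(p, q). SOME x. p x \<noteq> q x) ` (R \<times> R)"
  show "finite ?F" using assms by simp
  show "\<forall>p\<in>R. \<forall>q\<in>R. (\<forall>x\<in>?F. p x = q x) \<longrightarrow> p = q"
  proof (intro ballI impI, rule ccontr)
    fix p q assume pq: "p \<in> R" "q \<in> R" "\<forall>x\<in>?F. p x = q x" "p \<noteq> q"
    then have "\<exists>x. p x \<noteq> q x" by blast
    then have "p (SOME x. p x \<noteq> q x) \<noteq> q (SOME x. p x \<noteq> q x)" by (rule someI_ex)
    moreover have "(SOME x. p x \<noteq> q x) \<in> ?F"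
      using pq(1,2) by (intro image_eqI[of _ _ "(p, q)"]) simp_all
    ultimately show False using pq(3) by blast
  qed
qed

section \<open>Factors of a permutation and their number\<close>

lemma perm_factor_eq_iff:
  assumes "inj a"
  shows "perm_factor (perm_rel UNIV `` {a}) T i = perm_factor (perm_rel UNIV `` {a}) T j \<longleftrightarrow>
           (\<forall>s\<in>T. \<forall>r\<in>T. a (s + i) < a (r + i) \<longleftrightarrow> a (s + j) < a (r + j))"
proof -
  have inj: "(\<lambda>s. a (s + n)) \<in> {b. inj_on b T}" for n
    using assms by (auto intro!: inj_onI dest: injD)
  show ?thesis
    unfolding perm_factor_class[OF assms]
    using eq_equiv_class_iff[OF equiv_perm_rel inj[of i] inj[of j]] inj[of i] inj[of j]
    by (simp add: perm_rel_def)
qed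

lemma finite_range_perm_factor:
  assumes "\<alpha> \<in> infinite_permutations" "finite T"
  shows "finite (range (perm_factor \<alpha> T))"
proof (rule finite_subset)
  show "range (perm_factor \<alpha> T) \<subseteq> index_permutations T"
    using perm_factor_in_index_permutations[OF assms(1)] by blast
qed (use index_permutations_bound[OF assms(2)] in blast)

lemma factor_complexity_le_max:
  assumes "\<alpha> \<in> infinite_permutations" "window T"
  shows "factor_complexity \<alpha> T \<le> max_pattern_complexity \<alpha> (card T)"
  unfolding max_pattern_complexity_def
  using factor_complexity_set(1)[OF assms(1)] assms(2) by (intro Max_ge) auto

lemma max_pattern_complexity_attained:
  assumes "\<alpha> \<in> infinite_permutations" "n \<ge> 1"
  obtains T where "window T" "card T = n" "factor_complexity \<alpha> T = max_pattern_complexity \<alpha> n"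
  using Max_in[OF factor_complexity_set(1)[OF assms(1)] factor_complexity_set(2)[OF assms]]
  unfolding max_pattern_complexity_def by auto

text \<open>Beyond \<open>n0\<close> factors repeat with step \<open>t\<close>, so the positions up
  to \<open>n0 + t\<close> already show all of them. The bound is uniform in
  \<open>T\<close>.\<close>

lemma factor_complexity_ultimately_periodic:
  assumes a: "inj a" "\<alpha> = perm_rel UNIV `` {a}"
    and per: "t \<ge> 1" "\<forall>i j. i \<noteq> j \<and> i > n0 \<and> j > n0 \<longrightarrow>
      (perm_less \<alpha> i j \<longleftrightarrow> perm_less \<alpha> (i + t) (j + t))"
  shows "factor_complexity \<alpha> T \<le> Suc (n0 + t)"
proof -
  have shift: "perm_factor \<alpha> T (i + t) = perm_factor \<alpha> T i" if "i > n0" for i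
    unfolding a(2) perm_factor_eq_iff[OF a(1)]
  proof (intro ballI)
    fix s r
    \<comment> \<open>The first disjunct is the case \<open>s = r\<close>, excluded from the
      periodicity condition; there both comparisons are false.\<close>
    have "s + i = r + i \<or> (a (s + i) < a (r + i) \<longleftrightarrow> a (s + i + t) < a (r + i + t))"
      using per(2)[rule_format, of "s + i" "r + i"] that
      unfolding a(2) perm_less_class[OF a(1)] by auto
    then show "a (s + (i + t)) < a (r + (i + t)) \<longleftrightarrow> a (s + i) < a (r + i)"
      by (auto simp: add.assoc)
  qed
  have "perm_factor \<alpha> T i \<in> perm_factor \<alpha> T ` {..n0 + t}" for i
  proof (induction i rule: less_induct)
    case (less i)
    show ?case
    proof (cases "i \<le> n0 + t")
      case False
      then show ?thesis using less[of "i - t"] shift[of "i - t"] per(1) by auto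
    qed auto
  qed
  then have "range (perm_factor \<alpha> T) \<subseteq> perm_factor \<alpha> T ` {..n0 + t}" by auto
  then have "factor_complexity \<alpha> T \<le> card {..n0 + t}"
    unfolding factor_complexity_def by (intro surj_card_le) auto
  then show ?thesis by simp
qed

section \<open>The words \<open>a i < a (i + m)\<close>: one aperiodic, or all ultimately
  periodic\<close>

lemma max_pattern_complexity_ge_of_aperiodic_difference:
  assumes a: "inj a" "\<alpha> = perm_rel UNIV `` {a}" and \<alpha>: "\<alpha> \<in> infinite_permutations"
    and m: "m \<ge> 1" "\<not> ultimately_periodic_seq (\<lambda>i. a i < a (i + m))" and n: "n \<ge> 1"
  shows "max_pattern_complexity \<alpha> n \<ge> n"
proof -
  let ?v = "\<lambda>i. a i < a (i + m)"
  define T where "T = (\<lambda>j. j * m) ` {..<n}"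
  have "inj_on (\<lambda>j. j * m) {..<n}" using m(1) by (auto intro!: inj_onI)
  then have "card T = n" by (simp add: T_def card_image)
  have "0 \<in> T" using n unfolding T_def by (intro image_eqI[of _ _ 0]) auto
  have "finite T" by (simp add: T_def)
  with \<open>0 \<in> T\<close> have "window T" by (simp add: window_def)
  \<comment> \<open>The \<open>n\<close> points of \<open>T\<close> have \<open>n - 1\<close>
    neighbouring pairs, and comparing the pair \<open>l * m\<close>, \<open>Suc l * m\<close> at
    \<open>i\<close> reads the letter of \<open>?v\<close> at \<open>i + l * m\<close>.\<close>
  have "progression_factor ?v m (n - 1) i = progression_factor ?v m (n - 1) j"
    if "perm_factor \<alpha> T i = perm_factor \<alpha> T j" for i j
    unfolding progression_factor_eq_iff
  proof (intro allI impI)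
    fix l assume "l < n - 1"
    then have "l * m \<in> T" "Suc l * m \<in> T" unfolding T_def by (auto simp del: mult_Suc)
    then have "a (l * m + i) < a (Suc l * m + i) \<longleftrightarrow> a (l * m + j) < a (Suc l * m + j)"
      using that unfolding a(2) perm_factor_eq_iff[OF a(1)] by blast
    then show "?v (i + l * m) = ?v (j + l * m)" by (simp add: add_ac)
  qed
  then have "card (range (progression_factor ?v m (n - 1))) \<le> factor_complexity \<alpha> T"
    unfolding factor_complexity_def
    by (rule card_range_mono[OF finite_range_perm_factor[OF \<alpha> \<open>finite T\<close>]])
  moreover have "n - 1 < card (range (progression_factor ?v m (n - 1)))"
    using morse_hedlund_progression[OF m(1), of ?v "n - 1"] m(2) by linarith
  ultimately show ?thesis
    using factor_complexity_le_max[OF \<alpha> \<open>window T\<close>, unfolded \<open>card T = n\<close>] by linarith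
qed

text \<open>No point added to an optimal window \<open>T\<close> raises the number of factors, so
  the \<open>T\<close>-factor at \<open>i\<close> fixes the whole profile at \<open>i\<close>, and
  there are finitely many \<open>T\<close>-factors.\<close>

lemma finite_profiles_of_plateau:
  assumes a: "inj a" "\<alpha> = perm_rel UNIV `` {a}" and \<alpha>: "\<alpha> \<in> infinite_permutations"
    and n: "n \<ge> 1" "max_pattern_complexity \<alpha> (Suc n) \<le> max_pattern_complexity \<alpha> n"
  shows "finite (range (\<lambda>i m. a i < a (i + m)))"
proof -
  obtain T where T: "window T" "card T = n" "factor_complexity \<alpha> T = max_pattern_complexity \<alpha> n"
    using max_pattern_complexity_attained[OF \<alpha> n(1)] .
  then have "finite T" "0 \<in> T" by (auto simp: window_def)
  have det: "perm_factor \<alpha> (insert m T) i = perm_factor \<alpha> (insert m T) j"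
    if "perm_factor \<alpha> T i = perm_factor \<alpha> T j" for i j m
  proof (cases "m \<in> T")
    case True
    then show ?thesis using that by (simp add: insert_absorb)
  next
    case False
    then have "window (insert m T)" "card (insert m T) = Suc n"
      using \<open>finite T\<close> T by (auto simp: window_def)
    then have "factor_complexity \<alpha> (insert m T) \<le> factor_complexity \<alpha> T"
      using factor_complexity_le_max[OF \<alpha>, of "insert m T"] T(3) n(2) by simp
    then have "card (range (perm_factor \<alpha> (insert m T))) \<le> card (range (perm_factor \<alpha> T))"
      by (simp add: factor_complexity_def)
    moreover have "finite (range (perm_factor \<alpha> (insert m T)))"
      using finite_range_perm_factor[OF \<alpha>] \<open>finite T\<close> by simp
    moreover have "perm_factor \<alpha> T i = perm_factor \<alpha> T j"
      if "perm_factor \<alpha> (insert m T) i = perm_factor \<alpha> (insert m T) j" for i j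
      using that unfolding a(2) perm_factor_eq_iff[OF a(1)] by blast
    ultimately show ?thesis
      using card_range_le_determines[of "perm_factor \<alpha> (insert m T)" "perm_factor \<alpha> T"] that
      by blast
  qed
  let ?pr = "\<lambda>i m. a i < a (i + m)"
  have "?pr i = ?pr j" if "perm_factor \<alpha> T i = perm_factor \<alpha> T j" for i j
  proof
    fix m
    have "a (0 + i) < a (m + i) \<longleftrightarrow> a (0 + j) < a (m + j)"
      using det[OF that, of m] \<open>0 \<in> T\<close> unfolding a(2) perm_factor_eq_iff[OF a(1)] by blast
    then show "?pr i m = ?pr j m" by (simp add: add.commute)
  qed
  with finite_range_perm_factor[OF \<alpha> \<open>finite T\<close>] show ?thesis by (rule finite_range_mono)
qed

text \<open>A common period of the finitely many words indexed by a separating set \<open>F\<close>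
  makes the profiles at \<open>i\<close> and \<open>i + t\<close> agree on \<open>F\<close>, hence
  for every \<open>m\<close>, with a threshold independent of \<open>m\<close>.\<close>

lemma ultimately_periodic_of_finite_profiles:
  assumes a: "inj a" "\<alpha> = perm_rel UNIV `` {a}"
    and fin: "finite (range (\<lambda>i m. a i < a (i + m)))"
    and per: "\<And>m. ultimately_periodic_seq (\<lambda>i. a i < a (i + m))"
  shows "ultimately_periodic \<alpha>"
proof -
  obtain F where F: "finite F"
      "\<And>i j. (\<forall>m\<in>F. (a i < a (i + m)) = (a j < a (j + m))) \<Longrightarrow>
         (\<lambda>m. a i < a (i + m)) = (\<lambda>m. a j < a (j + m))"
    using finite_separating_set[OF fin] by (smt (verit) rangeI)
  obtain t n0 where t: "t \<ge> 1"
      "\<forall>m\<in>F. \<forall>i\<ge>n0. (a (i + t) < a (i + t + m)) = (a i < a (i + m))"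
    using common_period[OF F(1), of "\<lambda>m i. a i < a (i + m)"] per by blast
  have shift: "a i < a (i + m) \<longleftrightarrow> a (i + t) < a (i + m + t)" if "i \<ge> n0" for i m
    using fun_cong[OF F(2)[of i "i + t"], of m] t(2) that by (simp add: add_ac)
  have less: "a i < a j \<longleftrightarrow> a (i + t) < a (j + t)" if "i > n0" "i < j" for i j
    using shift[of i "j - i"] that by simp
  have "a i < a j \<longleftrightarrow> a (i + t) < a (j + t)" if "i \<noteq> j" "i > n0" "j > n0" for i j
  proof (cases "i < j")
    case False
    \<comment> \<open>Distinct values make each comparison the negation of the reversed one, which
      reduces \<open>j < i\<close> to the previous case.\<close>
    have "a i \<noteq> a j" "a (i + t) \<noteq> a (j + t)" using a(1) that by (auto dest: injD)
    then show ?thesis using less[of j i] False that by force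
  qed (use less that in blast)
  then show ?thesis
    unfolding ultimately_periodic_def ultimately_t_periodic_def a(2) perm_less_class[OF a(1)]
    using t(1) by blast
qed

section \<open>Aperiodicity and the linear lower bound\<close>

theorem theorem4:
  fixes \<alpha> :: "(nat \<Rightarrow> real) set"
  assumes "\<alpha> \<in> infinite_permutations"
  shows "\<not> ultimately_periodic \<alpha> \<longleftrightarrow> (\<forall>n\<ge>1. max_pattern_complexity \<alpha> n \<ge> n)"
proof -
  obtain a where a: "inj a" "\<alpha> = perm_rel UNIV `` {a}"
    using assms by (rule infinite_permutationE)
  show ?thesis
  proof
    assume np: "\<not> ultimately_periodic \<alpha>"
    show "\<forall>n\<ge>1. max_pattern_complexity \<alpha> n \<ge> n"
    proof (cases "\<exists>m\<ge>1. \<not> ultimately_periodic_seq (\<lambda>i. a i < a (i + m))")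
      case True
      then show ?thesis
        using max_pattern_complexity_ge_of_aperiodic_difference[OF a assms] by blast
    next
      case False
      have per: "ultimately_periodic_seq (\<lambda>i. a i < a (i + m))" for m
      proof (cases "m = 0")
        case True
        then show ?thesis by (auto simp: ultimately_periodic_seq_def)
      qed (use False in auto)
      show ?thesis
      proof (rule ccontr)
        assume "\<not> ?thesis"
        then obtain l where l: "l \<ge> 1" "max_pattern_complexity \<alpha> l < l"
          by (auto simp: not_le)
        \<comment> \<open>The growth argument starts at cardinality 1, as a window contains 0 and so
          is never empty.\<close>
        have "factor_complexity \<alpha> {0} \<ge> 1"
          using finite_range_perm_factor[OF assms, of "{0}"]
          by (simp add: factor_complexity_def Suc_le_eq card_gt_0_iff)
        then have "max_pattern_complexity \<alpha> 1 \<ge> 1"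
          using factor_complexity_le_max[OF assms, of "{0}"] by (simp add: window_def)
        then obtain n where n: "n \<ge> 1" "max_pattern_complexity \<alpha> (Suc n) \<le> max_pattern_complexity \<alpha> n"
          using slow_growth_plateau[of 1 0 "max_pattern_complexity \<alpha>" l] l by auto
        have "ultimately_periodic \<alpha>"
          using ultimately_periodic_of_finite_profiles[OF a
              finite_profiles_of_plateau[OF a assms n] per] .
        with np show False ..
      qed
    qed
  next
    assume ge: "\<forall>n\<ge>1. max_pattern_complexity \<alpha> n \<ge> n"
    show "\<not> ultimately_periodic \<alpha>"
    proof
      assume "ultimately_periodic \<alpha>"
      then obtain t n0 where t: "t \<ge> 1" "\<forall>i j. i \<noteq> j \<and> i > n0 \<and> j > n0 \<longrightarrow>
          (perm_less \<alpha> i j \<longleftrightarrow> perm_less \<alpha> (i + t) (j + t))"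
        unfolding ultimately_periodic_def ultimately_t_periodic_def by blast
      \<comment> \<open>One more than the uniform bound \<open>Suc (n0 + t)\<close> on the number of
        factors.\<close>
      let ?n = "Suc (Suc (n0 + t))"
      obtain T where "factor_complexity \<alpha> T = max_pattern_complexity \<alpha> ?n"
        using max_pattern_complexity_attained[OF assms, of ?n] by auto
      then have "max_pattern_complexity \<alpha> ?n < ?n"
        using factor_complexity_ultimately_periodic[OF a t, of T] by simp
      moreover have "max_pattern_complexity \<alpha> ?n \<ge> ?n" using ge by simp
      ultimately show False by simp
    qed
  qed
qed

end
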